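(* Let $m\geq 2$ be an integer and let $p>3$ be a prime with $p\neq m$. Then $$\mathcal{H}_{p,m}(p-1)\equiv-\frac{2\,\mathcal{T}^*_{p,m}(p)+2}{p}+\frac{\mathcal{T}^*_{p,m}(2p)+2}{4p}\pmod{p^2}.$$
   Context: For integers $r$, $m\geq 1$, $n\geq 0$ define $\mathcal{H}_{r,m}(n)=\sum_{1\leq k\leq n,\ k\equiv r \pmod m}\frac{1}{k}$ and $\mathcal{T}^*_{r,m}(n)=\sum_{0\leq k\leq n,\ k\equiv r\pmod m}(-1)^k\binom{n}{k}$. For rational numbers $a,b$ and a prime $p$, $a\equiv b\pmod{p^2}$ means that $(a-b)/p^2$, written in lowest terms, has denominator not divisible by $p$. *)

theory Defs
  imports "HOL-Number_Theory.Number_Theory"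
begin

definition harmonic_res :: "int \<Rightarrow> nat \<Rightarrow> nat \<Rightarrow> rat" where
  "harmonic_res r m n = (\<Sum>k | 1 \<le> k \<and> k \<le> n \<and> [int k = r] (mod int m). 1 / of_nat k)"

definition alt_binom_res :: "int \<Rightarrow> nat \<Rightarrow> nat \<Rightarrow> int" where
  "alt_binom_res r m n =
     (\<Sum>k | k \<le> n \<and> [int k = r] (mod int m). (-1) ^ k * int (n choose k))"

(* quotient_of returns numerator and (positive) denominator in lowest terms. *)
definition rat_cong_sq :: "nat \<Rightarrow> rat \<Rightarrow> rat \<Rightarrow> bool" where
  "rat_cong_sq p a b \<longleftrightarrow> \<not> int p dvd snd (quotient_of ((a - b) / of_nat p ^ 2))"

end

(* For 1 \<le> k < p write (-1)^k * binom(ap, k) = -(ap/k) * \<Prod>j<k. (1 - ap/j), whose product is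
   1 - ap H(k-1) modulo p^2.  In the combination of the cases a = 1 and a = 2 on the right-hand side
   the terms in H(k-1) cancel and leave 1/k.  The sum for 2p is symmetric under k \<mapsto> 2p - k, which
   fixes only k = p; that middle term is handled by Wolstenholme's congruence
   binom(2p, p) = 2 (mod p^3), which comes from binom(2p, p) = \<Sum>k. binom(p, k)^2
   and \<Sum>0<k<p. 1/k^2 = 0 (mod p). *)
theory Submission
  imports Defs
begin

section \<open>Rationals integral at a prime\<close>

text \<open>This is the localisation of the integers at \<open>p\<close>, for prime
  \<open>p\<close>. Any representing fraction is allowed, not only the reduced one, so closure under
  sums and products needs no cancellation argument.\<close>

definition p_integral :: "nat \<Rightarrow> rat \<Rightarrow> bool" where
  "p_integral p x \<longleftrightarrow> (\<exists>a b. \<not> int p dvd b \<and> x = of_int a / of_int b)"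

text \<open>Links the predicate to \<open>rat_cong_sq\<close>. If \<open>p\<close> divided the
  reduced denominator, cross-multiplying with a fraction whose denominator is prime to
  \<open>p\<close> would force \<open>p\<close> into the reduced numerator too, against
  coprimality.\<close>

lemma p_integral_iff_denominator:
  assumes "prime p"
  shows "p_integral p x \<longleftrightarrow> \<not> int p dvd snd (quotient_of x)"
proof
  assume "p_integral p x"
  then obtain a b where ab: "\<not> int p dvd b" "x = of_int a / of_int b"
    by (auto simp: p_integral_def)
  obtain c d where cd: "quotient_of x = (c, d)" by (cases "quotient_of x")
  have d: "d > 0" and cop: "coprime c d" and x: "x = of_int c / of_int d"
    using cd quotient_of_denom_pos quotient_of_coprime quotient_of_div by blast+
  have "b \<noteq> 0" using ab by auto
  then have "(of_int (a * d) :: rat) = of_int (c * b)"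
    using ab(2) x d by (simp add: field_simps)
  then have eq: "a * d = c * b" by (simp only: of_int_eq_iff)
  have pp: "prime (int p)" using assms by simp
  have "\<not> int p dvd d"
  proof
    assume "int p dvd d"
    then have "int p dvd c * b" using eq by (metis dvd_mult)
    then have "int p dvd c" using ab pp by (simp add: prime_dvd_mult_iff)
    with \<open>int p dvd d\<close> cop pp show False
      by (meson coprime_common_divisor not_prime_unit)
  qed
  then show "\<not> int p dvd snd (quotient_of x)" using cd by simp
next
  assume *: "\<not> int p dvd snd (quotient_of x)"
  have "x = of_int (fst (quotient_of x)) / of_int (snd (quotient_of x))"
    by (rule quotient_of_div) simp
  with * show "p_integral p x" unfolding p_integral_def by blast
qed

lemma p_integral_of_int [simp]: "prime p \<Longrightarrow> p_integral p (of_int a)"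
  unfolding p_integral_def by (intro exI[of _ a] exI[of _ 1]) auto

lemma p_integral_of_nat [simp]: "prime p \<Longrightarrow> p_integral p (of_nat a)"
  using p_integral_of_int[of p "int a"] by simp

lemma p_integral_0 [simp]: "prime p \<Longrightarrow> p_integral p 0"
  using p_integral_of_int[of p 0] by simp

lemma p_integral_1 [simp]: "prime p \<Longrightarrow> p_integral p 1"
  using p_integral_of_int[of p 1] by simp

lemma p_integral_numeral [simp]: "prime p \<Longrightarrow> p_integral p (numeral n)"
  using p_integral_of_int[of p "numeral n"] by simp

lemma p_integral_add:
  assumes "prime p" "p_integral p x" "p_integral p y"
  shows "p_integral p (x + y)"
proof -
  obtain a b c d where *: "\<not> int p dvd b" "x = of_int a / of_int b"
      "\<not> int p dvd d" "y = of_int c / of_int d"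
    using assms by (auto simp: p_integral_def)
  have "b \<noteq> 0" "d \<noteq> 0" using * by auto
  then have "x + y = of_int (a * d + c * b) / of_int (b * d)"
    using * by (simp add: field_simps)
  moreover have "\<not> int p dvd b * d"
    using * assms(1) by (simp add: prime_dvd_mult_iff)
  ultimately show ?thesis unfolding p_integral_def by blast
qed

lemma p_integral_mult:
  assumes "prime p" "p_integral p x" "p_integral p y"
  shows "p_integral p (x * y)"
proof -
  obtain a b c d where *: "\<not> int p dvd b" "x = of_int a / of_int b"
      "\<not> int p dvd d" "y = of_int c / of_int d"
    using assms by (auto simp: p_integral_def)
  then have "x * y = of_int (a * c) / of_int (b * d)" by simp
  moreover have "\<not> int p dvd b * d"
    using * assms(1) by (simp add: prime_dvd_mult_iff)
  ultimately show ?thesis unfolding p_integral_def by blast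
qed

lemma p_integral_minus:
  assumes "p_integral p x"
  shows "p_integral p (- x)"
  using assms unfolding p_integral_def by (metis minus_divide_left of_int_minus)

lemma p_integral_diff:
  "prime p \<Longrightarrow> p_integral p x \<Longrightarrow> p_integral p y \<Longrightarrow> p_integral p (x - y)"
  using p_integral_add[of p x "- y"] p_integral_minus by simp

lemma p_integral_power:
  "prime p \<Longrightarrow> p_integral p x \<Longrightarrow> p_integral p (x ^ n)"
  by (induction n) (auto intro: p_integral_mult)

lemma p_integral_sum:
  assumes "prime p" "\<And>i. i \<in> A \<Longrightarrow> p_integral p (f i)"
  shows "p_integral p (sum f A)"
  using assms by (induction A rule: infinite_finite_induct) (auto intro: p_integral_add)

lemma p_integral_inverse_nat:
  assumes "\<not> p dvd k"
  shows "p_integral p (1 / of_nat k)"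
  unfolding p_integral_def using assms by (intro exI[of _ 1] exI[of _ "int k"]) auto

lemma p_integral_inverse_less:
  assumes "0 < k" "k < p"
  shows "p_integral p (1 / of_nat k)"
  using assms by (intro p_integral_inverse_nat) (auto dest: dvd_imp_le)

lemmas p_integral_intros =
  p_integral_add p_integral_mult p_integral_minus p_integral_diff p_integral_power

section \<open>Binomial coefficients modulo prime powers\<close>

text \<open>In n(n-1)...(n-k)/(k+1)!, pairing n-j with j gives the factors (n-j)/j = -(1 - n/j).
  These absorb all signs but one. The index \<open>Suc k\<close> keeps the prefactor away from
  division by 0.\<close>

lemma alternating_binomial_eq_prod:
  "(-1) ^ Suc k * of_nat (n choose Suc k)
     = - (of_nat n / of_nat (Suc k)) * (\<Prod>j=1..k. 1 - of_nat n / of_nat j :: rat)"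
proof (induction k)
  case 0
  then show ?case by simp
next
  case (Suc k)
  define C :: "nat \<Rightarrow> rat" where "C = (\<lambda>i. of_nat (n choose i))"
  \<comment> \<open>The absorption identity gives the ratio of consecutive binomials over the
    rationals, with no case split on whether \<open>k\<close> exceeds \<open>n\<close>.\<close>
  have "of_nat n * C (Suc k) = of_nat (Suc k) * C (Suc k) + of_nat (Suc (Suc k)) * C (Suc (Suc k))"
    unfolding C_def binomial_gbinomial by (rule gbinomial_mult_1)
  then have C: "C (Suc (Suc k)) = (of_nat n - of_nat (Suc k)) / of_nat (Suc (Suc k)) * C (Suc k)"
    by (simp add: field_simps)
  have "(-1) ^ Suc (Suc k) * C (Suc (Suc k))
      = (of_nat (Suc k) - of_nat n) / of_nat (Suc (Suc k)) * ((-1) ^ Suc k * C (Suc k))"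
    unfolding C by (simp add: field_simps)
  also have "(-1) ^ Suc k * C (Suc k)
      = - (of_nat n / of_nat (Suc k)) * (\<Prod>j=1..k. 1 - of_nat n / of_nat j :: rat)"
    unfolding C_def by (rule Suc.IH)
  also have "(of_nat (Suc k) - of_nat n) / of_nat (Suc (Suc k)) *
        (- (of_nat n / of_nat (Suc k)) * (\<Prod>j=1..k. 1 - of_nat n / of_nat j :: rat))
      = - (of_nat n / of_nat (Suc (Suc k))) *
        ((\<Prod>j=1..k. 1 - of_nat n / of_nat j) * (1 - of_nat n / of_nat (Suc k)))"
    by (simp del: of_nat_Suc add: diff_divide_eq_iff)
  also have "\<dots> = - (of_nat n / of_nat (Suc (Suc k))) * (\<Prod>j=1..Suc k. 1 - of_nat n / of_nat j)"
    by simp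
  finally show ?case unfolding C_def .
qed

text \<open>First-order expansion in \<open>p\<close>; the remainder is integral because every
  \<open>j\<close> in the product is below \<open>p\<close>, hence invertible. It is kept as an
  explicit \<open>Q\<close> so that later identities can be divided by powers of \<open>p\<close>.
  The cases \<open>y = 1\<close> and \<open>y = 2\<close> serve binom(p, k) and binom(2p,
  k).\<close>

lemma prod_one_minus_expansion:
  fixes y :: rat
  assumes "prime p" "p_integral p y" "n < p"
  obtains Q where "p_integral p Q"
    "(\<Prod>j=1..n. 1 - y * of_nat p / of_nat j)
       = 1 - y * of_nat p * (\<Sum>j=1..n. 1 / of_nat j) + of_nat p ^ 2 * Q"
proof -
  have "\<exists>Q. p_integral p Q \<and> (\<Prod>j=1..n. 1 - y * of_nat p / of_nat j)
       = 1 - y * of_nat p * (\<Sum>j=1..n. 1 / of_nat j) + of_nat p ^ 2 * Q"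
    using assms(3)
  proof (induction n)
    case 0
    then show ?case using assms by (intro exI[of _ 0]) simp
  next
    case (Suc n)
    define t :: rat where "t = 1 / of_nat (Suc n)"
    define H :: rat where "H = (\<Sum>j=1..n. 1 / of_nat j)"
    have t: "p_integral p t"
      unfolding t_def using Suc by (intro p_integral_inverse_less) auto
    have H: "p_integral p H"
      unfolding H_def using Suc assms
      by (intro p_integral_sum p_integral_inverse_less) auto
    from Suc obtain Q where Q: "p_integral p Q"
      "(\<Prod>j=1..n. 1 - y * of_nat p / of_nat j) = 1 - y * of_nat p * H + of_nat p ^ 2 * Q"
      unfolding H_def by auto
    have "(\<Prod>j=1..Suc n. 1 - y * of_nat p / of_nat j)
        = (1 - y * of_nat p * H + of_nat p ^ 2 * Q) * (1 - y * of_nat p * t)"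
      unfolding t_def Q(2)[symmetric] by simp
    \<comment> \<open>The new remainder collects the old \<open>Q\<close>, the product of the two
      linear terms, and the cubic term with one factor \<open>p\<close> left inside.\<close>
    also have "\<dots> = 1 - y * of_nat p * (H + t)
        + of_nat p ^ 2 * (Q + y * y * H * t - y * t * of_nat p * Q)"
      by (simp add: algebra_simps power2_eq_square)
    also have "H + t = (\<Sum>j=1..Suc n. 1 / of_nat j)"
      by (simp add: H_def t_def)
    finally show ?case
      using Q(1) t H assms
      by (intro exI[of _ "Q + y * y * H * t - y * t * of_nat p * Q"] conjI p_integral_intros
          p_integral_of_nat)
  qed
  then show ?thesis using that by blast
qed

text \<open>The weights 2/p and -1/(2p) turn the two binomials into -2/k and +1/k times their
  expansions. The constants then cancel against 1/k, and the two contributions 2pH/k cancel each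
  other, leaving p^2 (Q2 - 2 Q1)/k.\<close>

lemma reciprocal_eq_binomials_mod_p_square:
  assumes "prime p" "0 < k" "k < p"
  shows "p_integral p ((1 / of_nat k + 2 * ((-1) ^ k * of_nat (p choose k)) / of_nat p
           - (-1) ^ k * of_nat (2 * p choose k) / (2 * of_nat p)) / of_nat p ^ 2)"
proof -
  obtain n where n: "k = Suc n" using assms by (cases k) auto
  then have "n < p" using assms by simp
  define H :: rat where "H = (\<Sum>j=1..n. 1 / of_nat j)"
  obtain Q1 where Q1: "p_integral p Q1"
    "(\<Prod>j=1..n. 1 - 1 * of_nat p / of_nat j) = 1 - 1 * of_nat p * H + of_nat p ^ 2 * Q1"
    unfolding H_def
    by (rule prod_one_minus_expansion[of p 1 n]) (use assms \<open>n < p\<close> in auto)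
  obtain Q2 where Q2: "p_integral p Q2"
    "(\<Prod>j=1..n. 1 - 2 * of_nat p / of_nat j) = 1 - 2 * of_nat p * H + of_nat p ^ 2 * Q2"
    unfolding H_def
    by (rule prod_one_minus_expansion[of p 2 n]) (use assms \<open>n < p\<close> in auto)
  have p0: "(of_nat p :: rat) \<noteq> 0" and k0: "(of_nat k :: rat) \<noteq> 0" using assms by auto
  have b1: "(-1) ^ k * of_nat (p choose k)
      = - (of_nat p / of_nat k) * (1 - of_nat p * H + of_nat p ^ 2 * Q1)"
    using alternating_binomial_eq_prod[of n p] Q1(2) n by simp
  have b2: "(-1) ^ k * of_nat (2 * p choose k)
      = - (2 * of_nat p / of_nat k) * (1 - 2 * of_nat p * H + of_nat p ^ 2 * Q2)"
    using alternating_binomial_eq_prod[of n "2 * p"] Q2(2) n by simp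
  have "(1 / of_nat k + 2 * ((-1) ^ k * of_nat (p choose k)) / of_nat p
           - (-1) ^ k * of_nat (2 * p choose k) / (2 * of_nat p)) / of_nat p ^ 2
      = (1 / of_nat k) * (Q2 - 2 * Q1)"
    unfolding b1 b2 using p0 k0 by (simp add: divide_simps) (simp add: algebra_simps power2_eq_square)
  also have "p_integral p \<dots>"
    using assms Q1 Q2
    by (intro p_integral_intros p_integral_inverse_less p_integral_numeral) auto
  finally show ?thesis .
qed

section \<open>The sum of reciprocal squares and Wolstenholme's congruence\<close>

text \<open>Doubling permutes the nonzero residues modulo \<open>p\<close>, so the sum is congruent to a quarter of
  itself, and 3 is invertible.\<close>

lemma sum_reciprocal_squares_mod_p:
  assumes "prime p" "p > 3"
  shows "p_integral p ((\<Sum>k=1..p-1. 1 / of_nat k ^ 2) / of_nat p)"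
proof -
  define S :: rat where "S = (\<Sum>k=1..p-1. 1 / of_nat k ^ 2)"
  have ndvd: "\<not> p dvd k" if "0 < k" "k < p" for k using that by (auto dest: dvd_imp_le)
  define r where "r = (\<lambda>k. 2 * k mod p)"
  have "inj_on r {1..p-1}"
  proof (rule inj_onI)
    fix x y assume xy: "x \<in> {1..p-1}" "y \<in> {1..p-1}" "r x = r y"
    then have "[2 * x = 2 * y] (mod p)" by (simp add: r_def cong_def)
    moreover have "coprime 2 p"
      using assms by (intro primes_coprime) auto
    ultimately have "[x = y] (mod p)" by (simp add: cong_mult_lcancel_nat)
    then show "x = y" using xy assms by (intro cong_less_modulus_unique_nat[of x y p]) auto
  qed
  moreover have r_in: "r k \<in> {1..p-1}" if "k \<in> {1..p-1}" for k
  proof -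
    have "\<not> p dvd 2 * k"
    proof -
      have "0 < k" "k < p" using that assms by auto
      then show ?thesis using assms ndvd[of k] ndvd[of 2] by (simp add: prime_dvd_mult_iff)
    qed
    then have "r k \<noteq> 0" by (simp add: r_def dvd_eq_mod_eq_0)
    moreover have "r k < p" using assms by (simp add: r_def)
    ultimately show ?thesis by simp
  qed
  ultimately have "r ` {1..p-1} = {1..p-1}"
    by (intro endo_inj_surj) auto
  with \<open>inj_on r {1..p-1}\<close> have S_r: "S = (\<Sum>k=1..p-1. 1 / of_nat (r k) ^ 2)"
    unfolding S_def using sum.reindex[of r "{1..p-1}" "\<lambda>k. 1 / of_nat k ^ 2 :: rat"]
    by (simp add: o_def)
  have p0: "(of_nat p :: rat) \<noteq> 0" using assms by auto
  have quarter: "(\<Sum>k=1..p-1. 1 / (4 * of_nat k ^ 2)) = S / 4"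
    unfolding S_def sum_divide_distrib by (simp add: mult.commute)
  \<comment> \<open>Termwise comparison: \<open>r k\<close> and 2k differ by a multiple of
    \<open>p\<close>, so their squares, and the reciprocals of these, agree modulo
    \<open>p\<close>.\<close>
  have "p_integral p ((1 / of_nat (r k) ^ 2 - 1 / (4 * of_nat k ^ 2)) / of_nat p)"
    if k: "k \<in> {1..p-1}" for k
  proof -
    define q where "q = 2 * k div p"
    have "2 * k = p * q + r k" unfolding q_def r_def by simp
    then have eq: "2 * of_nat k = of_nat p * of_nat q + (of_nat (r k) :: rat)"
      by (metis of_nat_add of_nat_mult of_nat_numeral)
    have rk: "0 < r k" "r k < p" using r_in[OF k] by auto
    have k': "0 < k" "k < p" using k by auto
    have nz: "(of_nat (r k) :: rat) \<noteq> 0" "(of_nat k :: rat) \<noteq> 0" using rk k' by auto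
    have "4 * of_nat k ^ 2 - of_nat (r k) ^ 2
        = (2 * of_nat k - of_nat (r k)) * (2 * of_nat k + of_nat (r k) :: rat)"
      by (simp add: algebra_simps power2_eq_square)
    also have "2 * of_nat k - of_nat (r k) = (of_nat p * of_nat q :: rat)" using eq by simp
    finally have num: "4 * of_nat k ^ 2 - of_nat (r k) ^ 2
        = of_nat p * of_nat q * (2 * of_nat k + of_nat (r k) :: rat)" .
    have "(1 / of_nat (r k) ^ 2 - 1 / (4 * of_nat k ^ 2)) / of_nat p
        = (4 * of_nat k ^ 2 - of_nat (r k) ^ 2) / (4 * of_nat k ^ 2 * of_nat (r k) ^ 2) / (of_nat p :: rat)"
      using nz by (simp add: field_simps)
    also have "\<dots> = of_nat q * (2 * of_nat k + of_nat (r k)) * (1 / of_nat 2) ^ 2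
        * (1 / of_nat k) ^ 2 * (1 / of_nat (r k)) ^ 2"
      unfolding num using p0 by (simp add: power_divide)
    also have "p_integral p \<dots>"
      using assms rk k'
      by (intro p_integral_intros p_integral_inverse_less p_integral_numeral p_integral_of_nat) auto
    finally show ?thesis .
  qed
  then have "p_integral p (\<Sum>k=1..p-1. (1 / of_nat (r k) ^ 2 - 1 / (4 * of_nat k ^ 2)) / of_nat p)"
    using assms by (intro p_integral_sum) auto
  also have "(\<Sum>k=1..p-1. (1 / of_nat (r k) ^ 2 - 1 / (4 * of_nat k ^ 2)) / (of_nat p :: rat))
      = (S - S / 4) / of_nat p"
    unfolding sum_divide_distrib[symmetric] sum_subtractf S_r[symmetric] quarter ..
  finally have *: "p_integral p ((S - S / 4) / of_nat p)" .
  \<comment> \<open>As S - S/4 = 3S/4, recovering \<open>S\<close> costs a factor 4/3, which is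
    integral because 3 < p.\<close>
  have "S / of_nat p = 4 * (1 / of_nat 3) * ((S - S / 4) / of_nat p)"
    using p0 by (simp add: field_simps)
  also have "p_integral p \<dots>"
    using assms * by (intro p_integral_mult p_integral_numeral p_integral_inverse_less) auto
  finally show ?thesis unfolding S_def .
qed

text \<open>In the sum of binom(p, k)^2 the end terms k = 0 and k = p account for the 2. Each inner
  term is p^2/k^2 modulo p^3, so only the reciprocal squares modulo \<open>p\<close> matter.\<close>

lemma wolstenholme_central_binomial:
  assumes "prime p" "p > 3"
  shows "p_integral p ((of_nat (2 * p choose p) - 2) / of_nat p ^ 3)"
proof -
  have p0: "(of_nat p :: rat) \<noteq> 0" using assms by auto
  have "\<exists>R. p_integral p R \<and>
      of_nat (p choose k) ^ 2 = of_nat p ^ 2 * (1 / of_nat k ^ 2) + of_nat p ^ 3 * R"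
    if k: "k \<in> {1..p-1}" for k
  proof -
    obtain n where n: "k = Suc n" using k by (cases k) auto
    then have "n < p" using k by simp
    define H :: rat where "H = (\<Sum>j=1..n. 1 / of_nat j)"
    obtain Q where Q: "p_integral p Q"
      "(\<Prod>j=1..n. 1 - 1 * of_nat p / of_nat j) = 1 - 1 * of_nat p * H + of_nat p ^ 2 * Q"
      unfolding H_def
      by (rule prod_one_minus_expansion[of p 1 n]) (use assms \<open>n < p\<close> in auto)
    have H: "p_integral p H"
      unfolding H_def using assms \<open>n < p\<close>
      by (intro p_integral_sum p_integral_inverse_less) auto
    \<comment> \<open>Everything beyond the constant 1 goes into \<open>W\<close>: precision modulo
      \<open>p\<close> suffices here, since the squared prefactor already supplies p^2.\<close>
    define W where "W = of_nat p * Q - H"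
    have W: "p_integral p W"
      unfolding W_def using Q H assms by (intro p_integral_intros) auto
    have "(\<Prod>j=1..n. 1 - of_nat p / of_nat j) = 1 + of_nat p * W"
      using Q(2) by (simp add: W_def algebra_simps power2_eq_square)
    then have "(-1) ^ k * of_nat (p choose k) = - (of_nat p / of_nat k) * (1 + of_nat p * W)"
      using alternating_binomial_eq_prod[of n p] n by simp
    \<comment> \<open>Squaring removes the sign. Then p^2 (1 + pW)^2 = p^2 + p^3 (2W + pW^2) yields
      the witness for \<open>R\<close>.\<close>
    then have "((-1) ^ k * of_nat (p choose k)) ^ 2
        = (- (of_nat p / of_nat k) * (1 + of_nat p * W)) ^ 2" by simp
    then have "of_nat (p choose k) ^ 2
        = of_nat p ^ 2 * (1 / of_nat k) ^ 2 * (1 + of_nat p * W) ^ 2"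
      by (simp add: power_mult_distrib power_divide flip: power_mult)
    also have "\<dots> = of_nat p ^ 2 * (1 / of_nat k ^ 2)
        + of_nat p ^ 3 * ((1 / of_nat k) ^ 2 * (2 * W + of_nat p * W ^ 2))"
      by (simp add: algebra_simps power2_eq_square power3_eq_cube)
    finally show ?thesis
      using W k assms
      by (intro exI[of _ "(1 / of_nat k) ^ 2 * (2 * W + of_nat p * W ^ 2)"] conjI p_integral_intros
          p_integral_inverse_less) auto
  qed
  then obtain R where R: "\<And>k. k \<in> {1..p-1} \<Longrightarrow> p_integral p (R k) \<and>
      of_nat (p choose k) ^ 2 = of_nat p ^ 2 * (1 / of_nat k ^ 2) + of_nat p ^ 3 * R k"
    by metis
  have "{..p} = insert 0 (insert p {1..p-1})" using assms by auto
  then have "(\<Sum>k\<le>p. (p choose k) ^ 2) = 2 + (\<Sum>k=1..p-1. (p choose k) ^ 2)"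
    using assms by auto
  then have "of_nat (2 * p choose p) - 2 = (\<Sum>k=1..p-1. of_nat (p choose k) ^ 2 :: rat)"
    unfolding choose_square_sum by simp
  also have "\<dots> = (\<Sum>k=1..p-1. of_nat p ^ 2 * (1 / of_nat k ^ 2) + of_nat p ^ 3 * R k)"
    using R by (intro sum.cong) auto
  also have "\<dots> = of_nat p ^ 2 * (\<Sum>k=1..p-1. 1 / of_nat k ^ 2) + of_nat p ^ 3 * (\<Sum>k=1..p-1. R k)"
    by (simp only: sum.distrib sum_distrib_left)
  finally have "(of_nat (2 * p choose p) - 2) / of_nat p ^ 3
      = (\<Sum>k=1..p-1. 1 / of_nat k ^ 2) / of_nat p + (\<Sum>k=1..p-1. R k)"
    using p0 by (simp add: field_simps power2_eq_square power3_eq_cube)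
  also have "p_integral p \<dots>"
    using assms R by (intro p_integral_add sum_reciprocal_squares_mod_p p_integral_sum) auto
  finally show ?thesis .
qed

section \<open>The congruence\<close>

text \<open>Brings the sum onto the index set of the harmonic sum: 0 is not in the class of
  \<open>p\<close> when \<open>m\<close> does not divide \<open>p\<close>, so only k = p is split
  off.\<close>

lemma alt_binom_res_self:
  assumes "\<not> m dvd p"
  shows "alt_binom_res (int p) m p
    = (-1) ^ p + (\<Sum>k | 1 \<le> k \<and> k \<le> p - 1 \<and> [int k = int p] (mod int m). (-1) ^ k * int (p choose k))"
proof -
  let ?A = "{k. 1 \<le> k \<and> k \<le> p - 1 \<and> [int k = int p] (mod int m)}"
  have "p \<noteq> 0" using assms by (metis dvd_0_right)
  have "\<not> [0 = int p] (mod int m)"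
    using assms by (metis cong_0_iff cong_sym int_dvd_int_iff)
  then have "{k. k \<le> p \<and> [int k = int p] (mod int m)} = insert p ?A"
    using \<open>p \<noteq> 0\<close> by (auto simp: Suc_le_eq intro!: gr0I)
  then show ?thesis
    using \<open>p \<noteq> 0\<close> by (auto simp: alt_binom_res_def)
qed

text \<open>The reflection of k to 2p - k preserves the class of \<open>p\<close>, the sign and the
  binomial coefficient. It exchanges the indices below \<open>p\<close> with those above, so each
  lower term counts twice and the fixed point gives the central binomial.\<close>

lemma alt_binom_res_double:
  assumes "\<not> m dvd p"
  shows "alt_binom_res (int p) m (2 * p)
    = (-1) ^ p * int (2 * p choose p)
      + 2 * (\<Sum>k | 1 \<le> k \<and> k \<le> p - 1 \<and> [int k = int p] (mod int m). (-1) ^ k * int (2 * p choose k))"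
proof -
  let ?A = "{k. 1 \<le> k \<and> k \<le> p - 1 \<and> [int k = int p] (mod int m)}"
  let ?f = "\<lambda>k. (-1) ^ k * int (2 * p choose k)"
  let ?s = "\<lambda>k. 2 * p - k"
  have "p \<noteq> 0" using assms by (metis dvd_0_right)
  have n0: "\<not> [0 = int p] (mod int m)"
    using assms by (metis cong_0_iff cong_sym int_dvd_int_iff)
  have refl_cong: "[int (2 * p - k) = int p] (mod int m) \<longleftrightarrow> [int k = int p] (mod int m)"
    if "k \<le> 2 * p" for k
  proof -
    have "int (2 * p - k) - int p = - (int k - int p)" using that by simp
    then show ?thesis by (simp add: cong_iff_dvd_diff del: of_nat_diff) (metis dvd_minus_iff minus_diff_eq)
  qed
  \<comment> \<open>The reflected indices stop at 2p - 1, yet the bound 2p is harmless: 2p in the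
    class would put its reflection 0 there, which \<open>n0\<close> excludes.\<close>
  have image: "?s ` ?A = {k. p < k \<and> k \<le> 2 * p \<and> [int k = int p] (mod int m)}"
  proof (intro equalityI subsetI)
    fix x assume "x \<in> ?s ` ?A"
    then obtain k where "k \<in> ?A" "x = 2 * p - k" by auto
    then show "x \<in> {k. p < k \<and> k \<le> 2 * p \<and> [int k = int p] (mod int m)}"
      using refl_cong[of k] \<open>p \<noteq> 0\<close> by auto
  next
    fix x assume x: "x \<in> {k. p < k \<and> k \<le> 2 * p \<and> [int k = int p] (mod int m)}"
    then have "[int (2 * p - x) = int p] (mod int m)" using refl_cong by simp
    moreover from this have "2 * p - x \<noteq> 0" using n0 by (metis of_nat_0)
    ultimately have "2 * p - x \<in> ?A" using x by auto
    moreover have "x = ?s (2 * p - x)" using x by auto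
    ultimately show "x \<in> ?s ` ?A" by blast
  qed
  have inj: "inj_on ?s ?A" by (auto intro!: inj_onI)
  have "{k. k \<le> 2 * p \<and> [int k = int p] (mod int m)} = insert p (?A \<union> ?s ` ?A)"
    unfolding image using n0 \<open>p \<noteq> 0\<close> by (auto simp: Suc_le_eq intro!: gr0I)
  moreover have "p \<notin> ?A \<union> ?s ` ?A" "?A \<inter> ?s ` ?A = {}"
    unfolding image using \<open>p \<noteq> 0\<close> by auto
  moreover have "finite ?A" by simp
  ultimately have "alt_binom_res (int p) m (2 * p) = ?f p + (sum ?f ?A + sum ?f (?s ` ?A))"
    unfolding alt_binom_res_def by (simp add: sum.union_disjoint)
  also have "sum ?f (?s ` ?A) = (\<Sum>k\<in>?A. ?f (2 * p - k))"
    using sum.reindex[OF inj, of ?f] by (simp add: o_def)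
  also have "\<dots> = sum ?f ?A"
  proof (rule sum.cong)
    fix k assume "k \<in> ?A"
    then have k: "k \<le> 2 * p" by auto
    then have "(2 * p choose (2 * p - k)) = (2 * p choose k)" using binomial_symmetric by metis
    moreover have "(-1 :: int) ^ (2 * p - k) = (-1) ^ k"
      using k by (simp add: minus_one_power_iff)
    ultimately show "?f (2 * p - k) = ?f k" by simp
  qed simp
  finally show ?thesis by simp
qed

theorem theorem1p1:
  fixes m p :: nat
  assumes "m \<ge> 2" and "prime p" and "p > 3" and "p \<noteq> m"
  shows "rat_cong_sq p
           (harmonic_res (int p) m (p - 1))
           (- ((2 * of_int (alt_binom_res (int p) m p) + 2) / of_nat p)
              + (of_int (alt_binom_res (int p) m (2 * p)) + 2) / (4 * of_nat p))"
proof -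
  let ?A = "{k. 1 \<le> k \<and> k \<le> p - 1 \<and> [int k = int p] (mod int m)}"
  define X :: rat where "X = (\<Sum>k\<in>?A. 1 / of_nat k)"
  define Y :: rat where "Y = (\<Sum>k\<in>?A. (-1) ^ k * of_nat (p choose k))"
  define Z :: rat where "Z = (\<Sum>k\<in>?A. (-1) ^ k * of_nat (2 * p choose k))"
  define B :: rat where "B = of_nat (2 * p choose p)"
  have "\<not> m dvd p" using assms by (auto simp: prime_nat_iff)
  moreover have "odd p" using assms prime_odd_nat by auto
  \<comment> \<open>Oddness of \<open>p\<close> makes the split-off terms -1 and
    \<open>- B\<close>.\<close>
  ultimately have T: "of_int (alt_binom_res (int p) m p) = Y - 1"
    "of_int (alt_binom_res (int p) m (2 * p)) = 2 * Z - B"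
    unfolding Y_def Z_def B_def
    by (simp_all add: alt_binom_res_self alt_binom_res_double)
  have p0: "(of_nat p :: rat) \<noteq> 0" using assms by auto
  have "p_integral p (\<Sum>k\<in>?A. (1 / of_nat k + 2 * ((-1) ^ k * of_nat (p choose k)) / of_nat p
           - (-1) ^ k * of_nat (2 * p choose k) / (2 * of_nat p)) / of_nat p ^ 2)"
    using assms by (intro p_integral_sum reciprocal_eq_binomials_mod_p_square) auto
  also have "(\<Sum>k\<in>?A. (1 / of_nat k + 2 * ((-1) ^ k * of_nat (p choose k)) / of_nat p
           - (-1) ^ k * of_nat (2 * p choose k) / (2 * of_nat p)) / of_nat p ^ 2)
      = (X + 2 * Y / of_nat p - Z / (2 * of_nat p)) / of_nat p ^ 2"
    unfolding X_def Y_def Z_def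
    by (simp only: sum_divide_distrib[symmetric] sum_subtractf sum.distrib sum_distrib_left[symmetric])
  finally have main: "p_integral p ((X + 2 * Y / of_nat p - Z / (2 * of_nat p)) / of_nat p ^ 2)" .
  \<comment> \<open>The +2 in the first numerator cancels the -1 in \<open>T\<close>. The second
    numerator leaves (B - 2)/(4p), and dividing by p^2 calls for Wolstenholme's congruence modulo
    p^3.\<close>
  have "(X - (- ((2 * (Y - 1) + 2) / of_nat p) + (2 * Z - B + 2) / (4 * of_nat p))) / of_nat p ^ 2
      = (X + 2 * Y / of_nat p - Z / (2 * of_nat p)) / of_nat p ^ 2
        + (1 / of_nat 2) ^ 2 * ((B - 2) / of_nat p ^ 3)"
    using p0 by (simp add: field_simps power2_eq_square power3_eq_cube)
  also have "p_integral p \<dots>"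
    unfolding B_def using assms main
    by (intro p_integral_add p_integral_mult p_integral_power p_integral_inverse_less
        wolstenholme_central_binomial) auto
  finally show ?thesis
    unfolding rat_cong_sq_def T harmonic_res_def X_def[symmetric]
    using p_integral_iff_denominator assms by blast
qed

end
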